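(* If $H$ and $K$ are isomorphic numerical semigroups, then there is only one isomorphism $\varphi:H\to K$, and it is an increasing function.
   Context: $\mathbb N=\{0,1,2,\ldots\}$. A numerical semigroup is a submonoid $H$ of $(\mathbb N,+)$ such that $\mathbb N\setminus H$ is finite. An isomorphism $\varphi:H\to K$ is a bijection with $\varphi(a+b)=\varphi(a)+\varphi(b)$ for all $a,b\in H$; $H$ and $K$ are isomorphic if such a map exists. Increasing refers to the usual order of $\mathbb N$. *)

theory Defs
  imports "HOL-Algebra.Group"
begin

definition nat_add :: "nat set \<Rightarrow> nat monoid" where
  "nat_add H = \<lparr>carrier = H, mult = (+), one = 0\<rparr>"

definition numerical_semigroup :: "nat set \<Rightarrow> bool" where
  "numerical_semigroup H \<longleftrightarrow> submonoid H (nat_add UNIV) \<and> finite (UNIV - H)"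

text \<open>
  Members of \<^term>\<open>iso G G'\<close> are total functions, whose values outside the carrier of
  \<^term>\<open>G\<close> are arbitrary. To count isomorphisms as maps with domain \<open>H\<close>, we take exactly one
  representative of each, the one that is \<^term>\<open>undefined\<close> outside \<open>H\<close>.
\<close>

definition semigroup_isos :: "nat set \<Rightarrow> nat set \<Rightarrow> (nat \<Rightarrow> nat) set" where
  "semigroup_isos H K = iso (nat_add H) (nat_add K) \<inter> extensional H"

end

theory Submission
  imports Defs
begin

text \<open>
  An additive map \<open>\<phi>\<close> on a submonoid \<open>H\<close> of the natural numbers is multiplication by a constant
  ratio: evaluating \<open>\<phi> (a * b)\<close> as an \<open>a\<close>-fold sum of \<open>b\<close> and as a \<open>b\<close>-fold sum of \<open>a\<close>
  gives \<open>a * \<phi> b = b * \<phi> a\<close> (lemma \<open>hom_proportional\<close>). For an injective \<open>\<phi>\<close> the ratio is positive,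
  so \<open>\<phi>\<close> is increasing (lemma \<open>iso_strict_mono\<close>).

  An increasing bijection onto \<open>K\<close> must send the least positive element of \<open>H\<close> to the least
  positive element of \<open>K\<close>, so any two isomorphisms agree at that point. There they determine
  the same ratio, hence they coincide on all of \<open>H\<close>.
\<close>

lemma numerical_semigroup_zero: "numerical_semigroup H \<Longrightarrow> 0 \<in> H"
  using submonoid.one_closed[of H "nat_add UNIV"]
  by (simp add: numerical_semigroup_def nat_add_def)

lemma numerical_semigroup_add:
  "numerical_semigroup H \<Longrightarrow> a \<in> H \<Longrightarrow> b \<in> H \<Longrightarrow> a + b \<in> H"
  using submonoid.m_closed[of H "nat_add UNIV" a b]
  by (simp add: numerical_semigroup_def nat_add_def)

lemma numerical_semigroup_has_positive:
  assumes "numerical_semigroup H"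
  shows "\<exists>m\<in>H. 0 < m"
proof (rule ccontr)
  assume "\<not> ?thesis"
  then have "H \<subseteq> {0}" by auto
  then have "finite H" by (rule finite_subset) simp
  moreover have "finite (UNIV - H)"
    using assms by (simp add: numerical_semigroup_def)
  ultimately have "finite (UNIV :: nat set)"
    by simp
  then show False by simp
qed

lemma hom_add:
  "\<phi> \<in> hom (nat_add H) (nat_add K) \<Longrightarrow> a \<in> H \<Longrightarrow> b \<in> H \<Longrightarrow> \<phi> (a + b) = \<phi> a + \<phi> b"
  by (simp add: hom_def nat_add_def)

lemma iso_nat_addD:
  assumes "\<phi> \<in> iso (nat_add H) (nat_add K)"
  shows "\<phi> \<in> hom (nat_add H) (nat_add K)" and "bij_betw \<phi> H K"
  using assms by (simp_all add: iso_def nat_add_def)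

lemma hom_zero:
  assumes "numerical_semigroup H" and "\<phi> \<in> hom (nat_add H) (nat_add K)"
  shows "\<phi> 0 = 0"
  using hom_add[OF assms(2), of 0 0] numerical_semigroup_zero[OF assms(1)] by simp

lemma hom_multiple:
  assumes "numerical_semigroup H" and "\<phi> \<in> hom (nat_add H) (nat_add K)" and "a \<in> H"
  shows "n * a \<in> H \<and> \<phi> (n * a) = n * \<phi> a"
proof (induction n)
  case 0
  show ?case
    using hom_zero[OF assms(1,2)] numerical_semigroup_zero[OF assms(1)] by simp
next
  case (Suc n)
  then show ?case
    using numerical_semigroup_add[OF assms(1,3)] hom_add[OF assms(2,3)] by simp
qed

text \<open>
  Both sides equal \<open>\<phi> (a * b)\<close>. This is the cross-multiplied form of the equality of the ratios
  \<open>\<phi> a / a\<close> and \<open>\<phi> b / b\<close>.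
\<close>

lemma hom_proportional:
  assumes "numerical_semigroup H" and "\<phi> \<in> hom (nat_add H) (nat_add K)"
    and "a \<in> H" and "b \<in> H"
  shows "a * \<phi> b = b * \<phi> a"
  using hom_multiple[OF assms(1,2,4), of a] hom_multiple[OF assms(1,2,3), of b]
  by (simp add: mult.commute)

lemma iso_pos:
  assumes "numerical_semigroup H" and "\<phi> \<in> iso (nat_add H) (nat_add K)"
    and "a \<in> H" and "0 < a"
  shows "0 < \<phi> a"
proof -
  have "inj_on \<phi> H"
    using iso_nat_addD(2)[OF assms(2)] by (rule bij_betw_imp_inj_on)
  then have "\<phi> a \<noteq> \<phi> 0"
    using assms(3,4) numerical_semigroup_zero[OF assms(1)] by (auto dest: inj_onD)
  then show ?thesis
    using hom_zero[OF assms(1) iso_nat_addD(1)[OF assms(2)]] by simp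
qed

text \<open>
  If \<open>a < b\<close>, then \<open>\<phi> b\<close> is positive, so replacing the factor \<open>a\<close> by \<open>b\<close> strictly increases
  \<open>a * \<phi> b = b * \<phi> a\<close> to \<open>b * \<phi> b\<close>, and \<open>b\<close> can be cancelled.
\<close>

lemma iso_strict_mono:
  assumes "numerical_semigroup H" and "\<phi> \<in> iso (nat_add H) (nat_add K)"
  shows "strict_mono_on H \<phi>"
proof (rule strict_mono_onI)
  fix a b assume ab: "a \<in> H" "b \<in> H" "a < b"
  have "0 < \<phi> b" using iso_pos[OF assms ab(2)] ab(3) by simp
  then have "a * \<phi> b < b * \<phi> b" using ab(3) by simp
  then have "b * \<phi> a < b * \<phi> b"
    using hom_proportional[OF assms(1) iso_nat_addD(1)[OF assms(2)] ab(1,2)] by simp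
  then show "\<phi> a < \<phi> b" by simp
qed

text \<open>
  The positive value \<open>\<phi> m\<close> is attained by \<open>\<psi>\<close> at a positive argument, which is at least \<open>m\<close>;
  monotonicity of \<open>\<psi>\<close> then bounds \<open>\<psi> m\<close> by \<open>\<phi> m\<close>. By symmetry, all isomorphisms agree at the
  least positive element.
\<close>

lemma iso_least_positive_le:
  assumes H: "numerical_semigroup H"
    and \<phi>: "\<phi> \<in> iso (nat_add H) (nat_add K)" and \<psi>: "\<psi> \<in> iso (nat_add H) (nat_add K)"
    and m: "m \<in> H" "0 < m" and least: "\<And>x. x \<in> H \<Longrightarrow> 0 < x \<Longrightarrow> m \<le> x"
  shows "\<psi> m \<le> \<phi> m"
proof -
  have "\<phi> m \<in> K"
    using iso_nat_addD(2)[OF \<phi>] m(1) by (rule bij_betwE[THEN bspec])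
  then obtain x where x: "x \<in> H" "\<psi> x = \<phi> m"
    using bij_betw_imp_surj_on[OF iso_nat_addD(2)[OF \<psi>]] by (metis imageE)
  have "x \<noteq> 0"
    using iso_pos[OF H \<phi> m] hom_zero[OF H iso_nat_addD(1)[OF \<psi>]] x(2)
    by (metis less_irrefl)
  then have "m \<le> x" using least x(1) by simp
  then have "\<psi> m \<le> \<psi> x"
    using strict_mono_onD[OF iso_strict_mono[OF H \<psi>] m(1) x(1)] by (cases "m = x") auto
  then show ?thesis using x(2) by simp
qed

lemma iso_unique:
  assumes H: "numerical_semigroup H"
    and \<phi>: "\<phi> \<in> iso (nat_add H) (nat_add K)" and \<psi>: "\<psi> \<in> iso (nat_add H) (nat_add K)"
    and a: "a \<in> H"
  shows "\<phi> a = \<psi> a"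
proof -
  define m where "m = (LEAST x. x \<in> H \<and> 0 < x)"
  have "\<exists>x. x \<in> H \<and> 0 < x"
    using numerical_semigroup_has_positive[OF H] by blast
  then have "m \<in> H \<and> 0 < m"
    unfolding m_def by (rule LeastI_ex)
  then have m: "m \<in> H" "0 < m" by simp_all
  have least: "m \<le> x" if "x \<in> H" "0 < x" for x
    unfolding m_def using that by (intro Least_le conjI)
  have "\<phi> m = \<psi> m"
    using iso_least_positive_le[OF H \<phi> \<psi> m least] iso_least_positive_le[OF H \<psi> \<phi> m least]
    by (rule antisym[rotated])
  then have "m * \<phi> a = m * \<psi> a"
    using hom_proportional[OF H iso_nat_addD(1)[OF \<phi>] m(1) a]
      hom_proportional[OF H iso_nat_addD(1)[OF \<psi>] m(1) a] by simp
  then show ?thesis using m(2) by simp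
qed

theorem lemma4p1:
  fixes H K :: "nat set"
  assumes "numerical_semigroup H"
    and "numerical_semigroup K"
    and "nat_add H \<cong> nat_add K"
  shows "(\<exists>!\<phi>. \<phi> \<in> semigroup_isos H K) \<and> (\<forall>\<phi>\<in>semigroup_isos H K. strict_mono_on H \<phi>)"
proof (intro conjI ballI)
  obtain f where f: "f \<in> iso (nat_add H) (nat_add K)"
    using assms(3) by (auto simp: is_iso_def)
  have "restrict f H \<in> iso (nat_add H) (nat_add K)"
    using f numerical_semigroup_add[OF assms(1)]
    by (auto simp: iso_def hom_def nat_add_def bij_betw_def inj_on_def)
  then have "restrict f H \<in> semigroup_isos H K"
    by (simp add: semigroup_isos_def)
  moreover have "\<phi> = \<psi>" if "\<phi> \<in> semigroup_isos H K" "\<psi> \<in> semigroup_isos H K" for \<phi> \<psi>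
    using that iso_unique[OF assms(1)]
    by (auto simp: semigroup_isos_def intro: extensionalityI)
  ultimately show "\<exists>!\<phi>. \<phi> \<in> semigroup_isos H K" by blast
next
  fix \<phi> assume "\<phi> \<in> semigroup_isos H K"
  then show "strict_mono_on H \<phi>"
    using iso_strict_mono[OF assms(1)] by (auto simp: semigroup_isos_def)
qed

end
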